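(* Let $a,b\in\mathbb{N}_0$ with $a+b\neq 0$ and let $\mathbf{c}=(c_1,c_2,\dots)$ be a sequence with $c_j\in\mathbb{N}_0$ for all $j\ge 1$. Let $y_n=\left|\mathfrak{D}^{\mathbf{c}}_n(a,b)\right|$ for $n\ge 1$, where $\mathfrak{D}^{\mathbf{c}}_n(a,b)$ is the set of colored Dyck words of semilength $(a+b)n$ defined in the context. Then for every $n\ge 1$, $$y_n=\sum_{k=1}^n\binom{an+bk}{k-1}\frac{(k-1)!}{n!}\,B_{n,k}(1!c_1,2!c_2,\dots),$$ where $B_{n,k}$ is the $(n,k)$-th partial Bell polynomial. Moreover, for every $n\ge 1$ and $1\le k\le n$, the quantity $$\binom{an+bk}{k-1}\frac{(k-1)!}{n!}\,B_{n,k}(1!c_1,2!c_2,\dots)$$ is the number of elements of $\mathfrak{D}^{\mathbf{c}}_n(a,b)$ having exactly $k$ peaks.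
   Context: $\mathbb{N}_0=\{0,1,2,\dots\}$. A Dyck word of semilength $m$ is a word in the letters $u$ and $d$ with exactly $m$ letters $u$ and $m$ letters $d$, such that every prefix contains at least as many $u$'s as $d$'s (it encodes a lattice path from $(0,0)$ to $(2m,0)$ staying in the first quadrant, with up-steps $u=(1,1)$ and down-steps $d=(1,-1)$). A peak is an occurrence of $ud$ as two consecutive letters. For $a,b\in\mathbb{N}_0$ with $a+b\ne 0$, $\mathbf{c}=(c_1,c_2,\dots)$ with $c_j\in\mathbb{N}_0$, and $n\ge 1$, the set $\mathfrak{D}^{\mathbf{c}}_n(a,b)$ consists of the Dyck words of semilength $(a+b)n$ that are concatenations of strings of the form $P_0=d$ and $P_j=u^{(a+b)j}d^{\,b(j-1)+1}$ for $j=1,\dots,n$ (each usable any number of times, in any order), such that each maximal $(a+b)j$-ascent substring $u^{(a+b)j}$ (maximal run of consecutive $u$'s, of length $(a+b)j$) is colored in one of $c_j$ different ways; $c_j=0$ means that maximal ascents of length $(a+b)j$ are not allowed. Elements of $\mathfrak{D}^{\mathbf{c}}_n(a,b)$ are words together with a choice of color for each maximal ascent; two elements are equal only if both the words and the colors agree. (Since each $P_j$ with $j\ge1$ ends in at least one $d$, the maximal ascents of such a word are exactly the blocks $u^{(a+b)j}$ of the strings $P_j$, $j\ge 1$, that occur.) For $1\le k\le n$, the $(n,k)$-th partial Bell polynomial is $$B_{n,k}(x_1,\dots,x_{n-k+1})=\sum_{\alpha\in\pi(n,k)}\frac{n!}{\alpha_1!\cdots\alpha_{n-k+1}!}\left(\frac{x_1}{1!}\right)^{\alpha_1}\cdots\left(\frac{x_{n-k+1}}{(n-k+1)!}\right)^{\alpha_{n-k+1}},$$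 where $\pi(n,k)$ is the set of $\alpha\in\mathbb{N}_0^{n-k+1}$ with $\alpha_1+\cdots+\alpha_{n-k+1}=k$ and $\alpha_1+2\alpha_2+\cdots+(n-k+1)\alpha_{n-k+1}=n$. The notation $B_{n,k}(1!c_1,2!c_2,\dots)$ means $x_j=j!\,c_j$ for $1\le j\le n-k+1$. *)

theory Defs
  imports Complex_Main "HOL-Library.FuncSet"
begin

datatype letter = u | d

definition dyck_word :: "nat \<Rightarrow> letter list \<Rightarrow> bool" where
  "dyck_word m w \<longleftrightarrow>
     count_list w u = m \<and> count_list w d = m \<and>
     (\<forall>i \<le> length w. count_list (take i w) d \<le> count_list (take i w) u)"

definition peaks :: "letter list \<Rightarrow> nat" where
  "peaks w = card {i. Suc i < length w \<and> w ! i = u \<and> w ! Suc i = d}"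

definition building_block :: "nat \<Rightarrow> nat \<Rightarrow> nat \<Rightarrow> letter list" where
  "building_block a b j =
     (if j = 0 then [d]
      else replicate ((a + b) * j) u @ replicate (b * (j - 1) + 1) d)"

text \<open>A maximal ascent is recorded as the pair of its starting position (counted from 0) and its
  length.\<close>

definition maximal_ascents :: "letter list \<Rightarrow> (nat \<times> nat) set" where
  "maximal_ascents w =
     {(i, l). 1 \<le> l \<and> i + l \<le> length w \<and>
        (\<forall>t. i \<le> t \<and> t < i + l \<longrightarrow> w ! t = u) \<and>
        (i = 0 \<or> w ! (i - 1) = d) \<and>
        (i + l = length w \<or> w ! (i + l) = d)}"

definition dyck_words_ab :: "nat \<Rightarrow> nat \<Rightarrow> nat \<Rightarrow> letter list set" where
  "dyck_words_ab a b n =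
     {w. dyck_word ((a + b) * n) w \<and>
         (\<exists>js. set js \<subseteq> {0..n} \<and> w = concat (map (building_block a b) js))}"

text \<open>The colors available for an ascent of length \<open>(a + b) * j\<close> are \<open>0, \<dots>, c j - 1\<close>. In a
  concatenation of building blocks every maximal ascent has length \<open>(a + b) * j\<close> for some
  \<open>j \<ge> 1\<close>, so the division below is exact; in particular the value \<open>c 0\<close> is never used.
  A coloring is extensional (\<open>undefined\<close> off the maximal ascents), so that
  colorings are equal iff they agree on every maximal ascent.\<close>

definition colored_dyck_words ::
    "nat \<Rightarrow> nat \<Rightarrow> (nat \<Rightarrow> nat) \<Rightarrow> nat \<Rightarrow> (letter list \<times> (nat \<times> nat \<Rightarrow> nat)) set" where
  "colored_dyck_words a b c n =
     (SIGMA w : dyck_words_ab a b n.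
        \<Pi>\<^sub>E (i, l) \<in> maximal_ascents w. {..<c (l div (a + b))})"

text \<open>Tuples \<open>(\<alpha>\<^sub>1, \<dots>, \<alpha>\<^bsub>n-k+1\<^esub>)\<close> are extensional functions on \<open>{1..n - k + 1}\<close>.
  Both definitions are meant for \<open>1 \<le> k \<le> n\<close>; for \<open>k > n\<close> the subtraction truncates.\<close>

definition bell_indices :: "nat \<Rightarrow> nat \<Rightarrow> (nat \<Rightarrow> nat) set" where
  "bell_indices n k =
     {\<alpha> \<in> {1..n - k + 1} \<rightarrow>\<^sub>E UNIV.
        (\<Sum>i = 1..n - k + 1. \<alpha> i) = k \<and> (\<Sum>i = 1..n - k + 1. i * \<alpha> i) = n}"

lemma finite_bell_indices: "finite (bell_indices n k)"
proof (rule finite_subset)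
  show "bell_indices n k \<subseteq> {1..n - k + 1} \<rightarrow>\<^sub>E {..k}"
  proof
    fix \<alpha> assume \<alpha>: "\<alpha> \<in> bell_indices n k"
    have "\<alpha> i \<le> k" if "i \<in> {1..n - k + 1}" for i
      using member_le_sum[of i "{1..n - k + 1}" \<alpha>] that \<alpha>
      unfolding bell_indices_def by simp
    with \<alpha> show "\<alpha> \<in> {1..n - k + 1} \<rightarrow>\<^sub>E {..k}"
      unfolding bell_indices_def PiE_def Pi_def by blast
  qed
qed (intro finite_PiE; simp)

definition partial_bell :: "nat \<Rightarrow> nat \<Rightarrow> (nat \<Rightarrow> 'a::field_char_0) \<Rightarrow> 'a" where
  "partial_bell n k x =
     (\<Sum>\<alpha> \<in> bell_indices n k.
        fact n / (\<Prod>i = 1..n - k + 1. fact (\<alpha> i)) *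
        (\<Prod>i = 1..n - k + 1. (x i / fact i) ^ \<alpha> i))"

end

theory Submission
  imports Defs "HOL-Combinatorics.Multiset_Permutations"
begin

text \<open>The blocks \<open>P\<^sub>j\<close> form a prefix code, so a word is the same thing as its list of block
  indices. A word with \<open>k\<close> peaks uses \<open>k\<close> nonzero indices of total \<open>n\<close>, and counting down-steps
  forces the list to have length \<open>N = a n + b k\<close>. Within a block the height is minimal at one of the
  two ends, so the Dyck condition only concerns the block heights, which are \<open>-1\<close> for \<open>P\<^sub>0\<close>
  and \<open>a j + b - 1 \<ge> 0\<close> for \<open>P\<^sub>j\<close>. Appending one more \<open>P\<^sub>0\<close> gives a list of length \<open>N + 1\<close>
  and total height \<open>-1\<close>; by the cycle lemma exactly one of its \<open>N + 1\<close> rotations is of this kind.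
  The unrestricted lists, weighted by their colorings, are counted by multinomial coefficients, which
  are the coefficients of the Bell polynomial.\<close>

section \<open>Walks and the cycle lemma\<close>

primrec nonneg_walk :: "('a \<Rightarrow> int) \<Rightarrow> int \<Rightarrow> 'a list \<Rightarrow> bool" where
  "nonneg_walk f h [] \<longleftrightarrow> 0 \<le> h"
| "nonneg_walk f h (x # xs) \<longleftrightarrow> 0 \<le> h \<and> nonneg_walk f (h + f x) xs"

lemma nonneg_walk_start: "nonneg_walk f h xs \<Longrightarrow> 0 \<le> h"
  by (cases xs) auto

lemma nonneg_walk_end: "nonneg_walk f h xs \<Longrightarrow> 0 \<le> h + sum_list (map f xs)"
  by (induction xs arbitrary: h) (auto simp flip: add.assoc)

lemma nonneg_walk_append:
  "nonneg_walk f h (xs @ ys) \<longleftrightarrow>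
     nonneg_walk f h xs \<and> nonneg_walk f (h + sum_list (map f xs)) ys"
  by (induction xs arbitrary: h) (auto simp: add.assoc dest: nonneg_walk_start)

lemma nonneg_walk_iff_take:
  "nonneg_walk f h xs \<longleftrightarrow> (\<forall>i \<le> length xs. 0 \<le> h + sum_list (map f (take i xs)))"
proof (induction xs arbitrary: h)
  case (Cons x xs)
  have "(\<forall>i \<le> length (x # xs). 0 \<le> h + sum_list (map f (take i (x # xs)))) \<longleftrightarrow>
      0 \<le> h \<and> (\<forall>i \<le> length xs. 0 \<le> h + f x + sum_list (map f (take i xs)))"
    by (simp add: All_less_Suc2 add.assoc flip: less_Suc_eq_le)
  then show ?case
    using Cons by simp
qed auto

text \<open>A prefix of a rotation is a cyclic window starting at \<open>r\<close>. A window that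
  ends exactly at the end of the list counts as not wrapping.\<close>

lemma sum_list_take_rotate:
  fixes xs :: "int list"
  assumes "r < length xs" "t \<le> length xs"
  shows "sum_list (take t (rotate r xs)) =
    (if r + t \<le> length xs then sum_list (take (r + t) xs) - sum_list (take r xs)
     else sum_list xs - sum_list (take r xs) + sum_list (take (r + t - length xs) xs))"
proof -
  have split: "sum_list (take r xs) + sum_list (drop r xs) = sum_list xs"
    by (metis append_take_drop_id sum_list_append)
  have "rotate r xs = drop r xs @ take r xs"
    using assms by (simp add: rotate_drop_take)
  moreover have "sum_list (take (r + t) xs) = sum_list (take r xs) + sum_list (take t (drop r xs))"
    by (simp add: take_add)
  ultimately show ?thesis
    using assms split by (auto simp: min_def add.commute[of t r])
qed

text \<open>A window from \<open>r\<close> ending at \<open>i\<close> sums to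
  \<open>s i - s r\<close>, or to \<open>s i - s r - 1\<close> once it has wrapped. Over the
  integers the latter is nonnegative iff \<open>s r < s i\<close>, which singles out one minimum
  among several.\<close>

lemma cycle_lemma:
  fixes xs :: "int list"
  assumes "sum_list xs = -1"
  shows "\<exists>!r. r < length xs \<and> (\<forall>t < length xs. 0 \<le> sum_list (take t (rotate r xs)))"
proof -
  define s where "s i = sum_list (take i xs)" for i
  let ?m = "length xs"
  have m: "0 < ?m"
    using assms by (cases xs) auto
  have s0: "s 0 = 0" and sm: "s ?m = -1"
    using assms by (auto simp: s_def)
  \<comment> \<open>The good rotations are those starting at the first minimum of the partial sums.\<close>
  have good_iff: "(\<forall>t < ?m. 0 \<le> sum_list (take t (rotate r xs))) \<longleftrightarrow>
      (\<forall>i < r. s r < s i) \<and> (\<forall>i < ?m. s r \<le> s i)" if r: "r < ?m" for r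
  proof (intro iffI conjI allI impI)
    fix i assume *: "\<forall>t < ?m. 0 \<le> sum_list (take t (rotate r xs))"
    show lt: "s r < s i" if "i < r" for i
    proof -
      \<comment> \<open>This window from \<open>r\<close> wraps around and ends at \<open>i\<close>.
        For \<open>i = 0\<close> it stops at the end of the list instead, with the same sum because
        \<open>s ?m = s 0 - 1\<close>.\<close>
      define t where "t = i + ?m - r"
      have t: "r + t = i + ?m" "t < ?m"
        using that r by (auto simp: t_def)
      have "0 \<le> sum_list (take t (rotate r xs))"
        using * t by blast
      then show ?thesis
        using sum_list_take_rotate[of r xs t] t(2) r assms
        by (cases "i = 0") (simp_all add: t(1) s_def)
    qed
    assume i: "i < ?m"
    show "s r \<le> s i"
    proof (cases "i < r")
      case False
      then show ?thesis
        using *[rule_format, of "i - r"] i r by (simp add: sum_list_take_rotate s_def)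
    qed (use lt in force)
  next
    fix t assume *: "(\<forall>i < r. s r < s i) \<and> (\<forall>i < ?m. s r \<le> s i)" and t: "t < ?m"
    consider "r + t < ?m" | "r + t = ?m" | "r + t > ?m"
      by linarith
    then show "0 \<le> sum_list (take t (rotate r xs))"
    proof cases
      case 1
      then have "s r \<le> s (r + t)"
        using * by blast
      then show ?thesis
        using r t 1 by (simp add: sum_list_take_rotate s_def)
    next
      case 2
      \<comment> \<open>Since \<open>t < ?m\<close>, position 0 lies strictly before
        \<open>r\<close>; the strict inequality makes up for the final value -1.\<close>
      then have "s r < s 0"
        using * t by (metis add_cancel_left_left gr0I less_irrefl)
      then have "s r \<le> s ?m"
        using s0 sm by simp
      then show ?thesis
        using r t 2 by (simp add: sum_list_take_rotate s_def)
    next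
      case 3
      then have "s r < s (r + t - ?m)"
        using * t by simp
      then show ?thesis
        using r t 3 assms by (simp add: sum_list_take_rotate s_def)
    qed
  qed
  obtain q where q: "q < ?m" "\<forall>i < ?m. s q \<le> s i"
    using m by (metis (no_types, lifting) arg_min_if_finite(1) arg_min_least finite_lessThan lessThan_iff lessThan_empty_iff less_irrefl)
  \<comment> \<open>The least minimizer is the first minimum; \<open>q\<close> shows that a
    minimizer exists.\<close>
  define r where "r = (LEAST r. r < ?m \<and> (\<forall>i < ?m. s r \<le> s i))"
  have r: "r < ?m" "\<forall>i < ?m. s r \<le> s i"
    unfolding r_def using LeastI[of "\<lambda>r. r < ?m \<and> (\<forall>i < ?m. s r \<le> s i)" q] q by auto
  have first: "s r < s i" if "i < r" for i
  proof (rule ccontr)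
    assume "\<not> s r < s i"
    then have "i < ?m \<and> (\<forall>j < ?m. s i \<le> s j)"
      using r that by (meson dual_order.strict_trans le_less_linear order_trans)
    then show False
      using not_less_Least[of i "\<lambda>r. r < ?m \<and> (\<forall>i < ?m. s r \<le> s i)"] that
      unfolding r_def by blast
  qed
  show ?thesis
  proof (rule ex1I)
    show "r < ?m \<and> (\<forall>t < ?m. 0 \<le> sum_list (take t (rotate r xs)))"
      using r first good_iff[of r] by blast
  next
    fix q assume q: "q < ?m \<and> (\<forall>t < ?m. 0 \<le> sum_list (take t (rotate q xs)))"
    then have "\<forall>i < q. s q < s i" "\<forall>i < ?m. s q \<le> s i"
      using good_iff[of q] by blast+
    then show "q = r"
      using r first q by (metis leD linorder_neqE_nat)
  qed
qed

section \<open>Words built from blocks\<close>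

abbreviation block_word :: "nat \<Rightarrow> nat \<Rightarrow> nat list \<Rightarrow> letter list" where
  "block_word a b js \<equiv> concat (map (building_block a b) js)"

abbreviation nonzeros :: "nat list \<Rightarrow> nat list" where
  "nonzeros \<equiv> filter (\<lambda>j. j \<noteq> 0)"

section \<open>Heights of letters and of blocks\<close>

definition letter_step :: "letter \<Rightarrow> int" where
  "letter_step x = (case x of u \<Rightarrow> 1 | d \<Rightarrow> -1)"

definition block_step :: "nat \<Rightarrow> nat \<Rightarrow> nat \<Rightarrow> int" where
  "block_step a b j = (if j = 0 then -1 else int (a * j + b) - 1)"

text \<open>Used to see that a step from a nonnegative height to -1 must be the block
  \<open>P_0\<close>.\<close>

lemma block_step_neg_iff:
  assumes "a + b \<noteq> 0"
  shows "block_step a b j < 0 \<longleftrightarrow> j = 0"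
proof -
  have "0 < a * j + b" if "j \<noteq> 0"
    using assms that by auto
  then have "0 < int (a * j + b)" if "j \<noteq> 0"
    using that by (metis of_nat_0_less_iff)
  then show ?thesis
    by (auto simp: block_step_def simp del: of_nat_add of_nat_mult)
qed

lemma sum_list_letter_step:
  "sum_list (map letter_step w) = int (count_list w u) - int (count_list w d)"
proof (induction w)
  case (Cons x w)
  then show ?case
    by (cases x) (auto simp: letter_step_def)
qed simp

lemma dyck_word_iff:
  "dyck_word m w \<longleftrightarrow>
     count_list w u = m \<and> count_list w d = m \<and> nonneg_walk letter_step 0 w"
  by (auto simp: dyck_word_def nonneg_walk_iff_take sum_list_letter_step)

lemma nonneg_walk_replicate_u:
  "nonneg_walk letter_step h (replicate m u) \<longleftrightarrow> 0 \<le> h"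
proof (induction m arbitrary: h)
  case (Suc m)
  show ?case
    unfolding replicate_Suc nonneg_walk.simps Suc.IH by (auto simp: letter_step_def)
qed simp

lemma nonneg_walk_replicate_d:
  "nonneg_walk letter_step h (replicate m d) \<longleftrightarrow> int m \<le> h"
  by (induction m arbitrary: h) (auto simp: letter_step_def)

lemma count_list_replicate: "count_list (replicate m x) y = (if x = y then m else 0)"
  by (induction m) auto

lemma count_building_block:
  "count_list (building_block a b j) u = (a + b) * j"
  "count_list (building_block a b j) d = (if j = 0 then 1 else b * (j - 1) + 1)"
  by (auto simp: building_block_def count_list_replicate)

lemma sum_list_building_block:
  "sum_list (map letter_step (building_block a b j)) = block_step a b j"
  by (cases j) (auto simp: sum_list_letter_step count_building_block block_step_def algebra_simps)

lemma nonneg_walk_building_block: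
  "nonneg_walk letter_step h (building_block a b j) \<longleftrightarrow> 0 \<le> h \<and> 0 \<le> h + block_step a b j"
proof (cases j)
  case 0
  then show ?thesis
    by (auto simp: building_block_def block_step_def letter_step_def)
next
  case (Suc j')
  then have "nonneg_walk letter_step h (building_block a b j) \<longleftrightarrow>
      0 \<le> h \<and> int (b * j' + 1) \<le> h + int ((a + b) * j)"
    by (simp add: building_block_def nonneg_walk_append nonneg_walk_replicate_u
        nonneg_walk_replicate_d map_replicate sum_list_replicate letter_step_def
        del: of_nat_add of_nat_mult replicate_Suc)
  also have "\<dots> \<longleftrightarrow> 0 \<le> h \<and> 0 \<le> h + block_step a b j"
    using Suc by (simp add: block_step_def algebra_simps)
  finally show ?thesis .
qed

lemma nonneg_walk_block_word:
  "nonneg_walk letter_step h (block_word a b js) \<longleftrightarrow> nonneg_walk (block_step a b) h js"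
  by (induction js arbitrary: h)
     (auto simp: nonneg_walk_append nonneg_walk_building_block sum_list_building_block
       dest: nonneg_walk_start)

text \<open>A nonzero \<open>j\<close> contributes \<open>b * j + 1 - b\<close> letters
  \<open>d\<close>; moving the \<open>b\<close> to the left side avoids subtraction on
  naturals.\<close>

lemma count_block_word:
  "count_list (block_word a b js) u = (a + b) * sum_list js"
  "count_list (block_word a b js) d + b * length (nonzeros js) = length js + b * sum_list js"
proof -
  show "count_list (block_word a b js) u = (a + b) * sum_list js"
    by (induction js) (simp_all add: count_building_block algebra_simps)
  show "count_list (block_word a b js) d + b * length (nonzeros js) = length js + b * sum_list js"
  proof (induction js)
    case (Cons j js)
    then show ?case
      by (cases j) (simp_all add: count_building_block algebra_simps)
  qed simp
qed

text \<open>With total \<open>n\<close> and \<open>k\<close> nonzero entries, the second equation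
  becomes \<open>length js = a * n + b * k\<close>.\<close>

lemma dyck_word_block_word_iff:
  "dyck_word ((a + b) * n) (block_word a b js) \<longleftrightarrow>
     (a + b) * sum_list js = (a + b) * n \<and>
     length js + b * sum_list js = (a + b) * n + b * length (nonzeros js) \<and>
     nonneg_walk (block_step a b) 0 js"
proof -
  have "count_list (block_word a b js) d = (a + b) * n \<longleftrightarrow>
      length js + b * sum_list js = (a + b) * n + b * length (nonzeros js)"
    using count_block_word(2)[of a b js] by linarith
  then show ?thesis
    by (simp only: dyck_word_iff count_block_word(1) nonneg_walk_block_word)
qed

section \<open>Unique decoding\<close>

lemma building_block_nonempty: "building_block a b j \<noteq> []"
  by (simp add: building_block_def)

lemma building_block_pos:
  assumes "j \<noteq> 0"
  shows "building_block a b j = replicate ((a + b) * j) u @ d # replicate (b * (j - 1)) d"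
  using assms by (simp add: building_block_def)

text \<open>Every block has a \<open>d\<close> right after its (possibly empty) ascent, so the
  leading run of \<open>u\<close> cannot reach into \<open>w\<close>.\<close>

lemma takeWhile_building_block:
  "takeWhile (\<lambda>x. x = u) (building_block a b j @ w) = replicate ((a + b) * j) u"
  by (cases "j = 0") (simp_all add: building_block_pos takeWhile_append, simp add: building_block_def)

text \<open>The leading run of \<open>u\<close> has length \<open>(a + b) * j\<close>, which
  determines the first index \<open>j\<close>; then the first block cancels.\<close>

lemma inj_block_word:
  assumes "a + b \<noteq> 0"
  shows "inj (block_word a b)"
proof (rule injI)
  fix js js' assume "block_word a b js = block_word a b js'"
  then show "js = js'"
  proof (induction js arbitrary: js')
    case Nil
    then show ?case
      by (cases js') (auto simp: building_block_nonempty)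
  next
    case (Cons j js)
    from Cons.prems obtain j' js'' where js': "js' = j' # js''"
      by (cases js') (auto simp: building_block_nonempty)
    have "replicate ((a + b) * j) u = replicate ((a + b) * j') u"
      using arg_cong[OF Cons.prems, of "takeWhile (\<lambda>x. x = u)"]
      by (simp add: js' takeWhile_building_block)
    then have "j = j'"
      using assms by (metis length_replicate mult_cancel1)
    then show ?case
      using Cons js' by simp
  qed
qed

section \<open>Maximal ascents, numbers of colorings, and peaks\<close>

lemma finite_maximal_ascents: "finite (maximal_ascents w)"
  by (rule finite_subset[of _ "{..length w} \<times> {..length w}"]) (auto simp: maximal_ascents_def)

lemma maximal_ascents_Nil: "maximal_ascents [] = {}"
  by (auto simp: maximal_ascents_def)

lemma ascent_nth:
  "(replicate m u @ d # w) ! t = (if t < m then u else if t = m then d else w ! (t - Suc m))"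
  by (auto simp: nth_append nth_Cons')

text \<open>The \<open>d\<close> at position \<open>m\<close> lies in no run, so each maximal ascent
  is entirely before or entirely after it. The case \<open>m = 0\<close> strips a single
  \<open>d\<close>.\<close>

lemma maximal_ascents_append:
  "maximal_ascents (replicate m u @ d # w) =
     (if m = 0 then {} else {(0, m)}) \<union> (\<lambda>(i, l). (i + Suc m, l)) ` maximal_ascents w"
    (is "?L = ?A \<union> ?f ` _")
proof (intro equalityI subsetI)
  let ?v = "replicate m u @ d # w"
  fix p assume "p \<in> ?L"
  moreover obtain i l where p: "p = (i, l)"
    by (cases p)
  ultimately have l: "1 \<le> l" and len: "i + l \<le> Suc m + length w"
    and run: "\<And>t. i \<le> t \<Longrightarrow> t < i + l \<Longrightarrow> ?v ! t = u"
    and before: "i = 0 \<or> ?v ! (i - 1) = d"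
    and after: "i + l = Suc m + length w \<or> ?v ! (i + l) = d"
    by (auto simp: maximal_ascents_def)
  have m: "\<not> (i \<le> m \<and> m < i + l)"
    using run[of m] by (auto simp: ascent_nth)
  show "p \<in> ?A \<union> ?f ` maximal_ascents w"
  proof (cases "i \<le> m")
    case True
    then have "i + l \<le> m"
      using m by simp
    \<comment> \<open>All letters before position \<open>m\<close> are \<open>u\<close>, so
      maximality pushes both ends of the run outwards.\<close>
    then have "i = 0" "i + l = m"
      using before after l by (auto simp: ascent_nth split: if_splits)
    then show ?thesis
      using p l by simp
  next
    case False
    then obtain i' where i': "i = i' + Suc m"
      by (metis add.commute less_iff_Suc_add not_le add_Suc_right)
    have "(i', l) \<in> maximal_ascents w"
    proof -
      have "w ! t = u" if "i' \<le> t \<and> t < i' + l" for t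
        using run[of "t + Suc m"] that by (simp add: ascent_nth i')
      moreover have "i' = 0 \<or> w ! (i' - 1) = d"
        using before by (auto simp: ascent_nth i' split: if_splits)
      moreover have "i' + l = length w \<or> w ! (i' + l) = d"
        using after by (auto simp: ascent_nth i' split: if_splits)
      ultimately show ?thesis
        using l len i' by (simp add: maximal_ascents_def)
    qed
    then show ?thesis
      using p i' by force
  qed
next
  fix p assume "p \<in> ?A \<union> ?f ` maximal_ascents w"
  then show "p \<in> ?L"
  proof
    assume "p \<in> ?A"
    then show ?thesis
      by (auto simp: maximal_ascents_def ascent_nth split: if_splits)
  next
    assume "p \<in> ?f ` maximal_ascents w"
    then obtain i l where p: "p = (i + Suc m, l)" "(i, l) \<in> maximal_ascents w"
      by auto
    then have "w ! (t - Suc m) = u" if "i + Suc m \<le> t" "t < i + Suc m + l" for t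
      using that unfolding maximal_ascents_def by (auto dest: spec[of _ "t - Suc m"])
    then show ?thesis
      using p by (auto simp: maximal_ascents_def ascent_nth)
  qed
qed

text \<open>The factor \<open>g l\<close> sees only the length of an ascent, so shifting the
  positions by \<open>Suc m\<close> leaves the product unchanged.\<close>

lemma prod_maximal_ascents_append:
  "(\<Prod>(i, l) \<in> maximal_ascents (replicate m u @ d # w). g l) =
     (if m = 0 then 1 else g m) * (\<Prod>(i, l) \<in> maximal_ascents w. g l)"
proof -
  define A where "A = (\<lambda>(i, l). (i + Suc m, l)) ` maximal_ascents w"
  have "inj_on (\<lambda>(i, l). (i + Suc m, l)) (maximal_ascents w)"
    by (auto simp: inj_on_def)
  then have "(\<Prod>(i, l) \<in> A. g l) = (\<Prod>(i, l) \<in> maximal_ascents w. g l)"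
    unfolding A_def by (subst prod.reindex) (auto intro!: prod.cong)
  moreover have "(0, m) \<notin> A" "finite A"
    by (auto simp: A_def finite_maximal_ascents)
  ultimately show ?thesis
    unfolding maximal_ascents_append A_def[symmetric] by simp
qed

lemma prod_maximal_ascents_replicate_d:
  "(\<Prod>(i, l) \<in> maximal_ascents (replicate m d @ w). g l) = (\<Prod>(i, l) \<in> maximal_ascents w. g l)"
  using prod_maximal_ascents_append[where m = 0 and g = g] by (induction m) auto

text \<open>For \<open>g = c\<close> this is the number of colorings of the word. Each nonzero
  \<open>j\<close> yields one ascent, of length \<open>(a + b) * j\<close>, and the division
  recovers \<open>j\<close>.\<close>

lemma prod_maximal_ascents_block_word:
  assumes "a + b \<noteq> 0"
  shows "(\<Prod>(i, l) \<in> maximal_ascents (block_word a b js). g (l div (a + b))) =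
    prod_list (map g (nonzeros js))"
proof (induction js)
  case (Cons j js)
  let ?g = "\<lambda>l. g (l div (a + b))"
  show ?case
  proof (cases "j = 0")
    case True
    then show ?thesis
      using Cons prod_maximal_ascents_append[where m = 0 and g = ?g]
      by (simp add: building_block_def)
  next
    case False
    moreover have "(a + b) * j div (a + b) = j"
      using assms by (intro nonzero_mult_div_cancel_left)
    ultimately show ?thesis
      using Cons assms
      by (auto simp: building_block_pos prod_maximal_ascents_append[where g = ?g]
          prod_maximal_ascents_replicate_d[where g = ?g])
  qed
qed (simp add: maximal_ascents_Nil)

text \<open>The \<open>d\<close> at position \<open>m\<close> can end a peak but not begin one, so
  no peak straddles the boundary to \<open>w\<close>.\<close>

lemma peaks_append:
  "peaks (replicate m u @ d # w) = (if m = 0 then 0 else 1) + peaks w"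
proof -
  let ?P = "\<lambda>w. {i. Suc i < length w \<and> w ! i = u \<and> w ! Suc i = d}"
  let ?v = "replicate m u @ d # w"
  have fin: "finite (?P w)"
    by (rule finite_subset[of _ "{..length w}"]) auto
  have "?P ?v = (if m = 0 then {} else {m - 1}) \<union> (\<lambda>i. i + Suc m) ` ?P w"
  proof (intro equalityI subsetI)
    fix i assume i: "i \<in> ?P ?v"
    then have v: "?v ! i = u" "?v ! Suc i = d" and len: "Suc i < Suc m + length w"
      by auto
    consider "i = m" | "Suc i < m" | "Suc i = m" | "i > m"
      by linarith
    then show "i \<in> (if m = 0 then {} else {m - 1}) \<union> (\<lambda>i. i + Suc m) ` ?P w"
    proof cases
      case 4
      then obtain i' where "i = i' + Suc m"
        by (metis add.commute less_iff_Suc_add add_Suc_right)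
      then show ?thesis
        using v len by (auto simp: ascent_nth)
    qed (use v in \<open>auto simp: ascent_nth\<close>)
  next
    fix i assume "i \<in> (if m = 0 then {} else {m - 1}) \<union> (\<lambda>i. i + Suc m) ` ?P w"
    then consider "m \<noteq> 0" "i = m - 1" | i' where "i = i' + Suc m" "i' \<in> ?P w"
      by (auto split: if_splits)
    then show "i \<in> ?P ?v"
      by cases (auto simp: ascent_nth)
  qed
  moreover define A where "A = (\<lambda>i. i + Suc m) ` ?P w"
  ultimately have "?P ?v = (if m = 0 then {} else {m - 1}) \<union> A"
    by simp
  moreover have "m - 1 \<notin> A" "finite A"
    using fin by (auto simp: A_def)
  ultimately have "card (?P ?v) = (if m = 0 then 0 else 1) + card A"
    by simp
  moreover have "card A = card (?P w)"
    unfolding A_def by (rule card_image) (auto simp: inj_on_def)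
  ultimately show ?thesis
    unfolding peaks_def by simp
qed

lemma peaks_replicate_d: "peaks (replicate m d @ w) = peaks w"
  using peaks_append[of 0] by (induction m) auto

lemma peaks_block_word:
  assumes "a + b \<noteq> 0"
  shows "peaks (block_word a b js) = length (nonzeros js)"
proof (induction js)
  case (Cons j js)
  show ?case
  proof (cases "j = 0")
    case True
    then show ?thesis
      using Cons peaks_append[of 0] by (simp add: building_block_def)
  next
    case False
    then show ?thesis
      using Cons assms by (simp add: building_block_pos peaks_append peaks_replicate_d)
  qed
qed (simp add: peaks_def)

section \<open>Lists with prescribed multiplicities\<close>

text \<open>Candidate codes with the height condition left out, so that the set is closed under
  rotation.\<close>

definition block_lists :: "nat \<Rightarrow> nat \<Rightarrow> nat \<Rightarrow> nat list set" where
  "block_lists m k n = {js. length js = m \<and> length (nonzeros js) = k \<and> sum_list js = n}"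

lemma length_nonzeros_le_sum_list: "length (nonzeros js) \<le> sum_list js"
  by (induction js) auto

text \<open>If \<open>x\<close> is nonzero, the other nonzero entries contribute at least 1 each to
  the total. This gives the range up to \<open>n - k + 1\<close> in the Bell polynomial.\<close>

lemma member_add_length_nonzeros_le:
  "x \<in> set js \<Longrightarrow> x + length (nonzeros js) \<le> Suc (sum_list js)"
proof (induction js)
  case (Cons j js)
  then show ?case
    using length_nonzeros_le_sum_list[of js] by auto
qed simp

lemma finite_block_lists: "finite (block_lists m k n)"
  by (rule finite_subset[OF _ finite_lists_length_eq[of "{..n}" m]])
     (auto simp: block_lists_def dest: member_le_sum_list)

definition bell_mset :: "nat \<Rightarrow> nat \<Rightarrow> (nat \<Rightarrow> nat) \<Rightarrow> nat multiset" where
  "bell_mset z m \<alpha> = replicate_mset z 0 + (\<Sum>i = 1..m. replicate_mset (\<alpha> i) i)"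

lemma bell_mset_0: "bell_mset z 0 \<alpha> = replicate_mset z 0"
  and bell_mset_Suc: "bell_mset z (Suc m) \<alpha> = bell_mset z m \<alpha> + replicate_mset (\<alpha> (Suc m)) (Suc m)"
  by (simp_all add: bell_mset_def)

lemma count_bell_mset:
  "count (bell_mset z m \<alpha>) i = (if i = 0 then z else if i \<le> m then \<alpha> i else 0)"
  by (induction m) (auto simp: bell_mset_0 bell_mset_Suc le_Suc_eq)

lemma size_bell_mset: "size (bell_mset z m \<alpha>) = z + (\<Sum>i = 1..m. \<alpha> i)"
  by (induction m) (auto simp: bell_mset_0 bell_mset_Suc)

lemma sum_mset_bell_mset: "\<Sum>\<^sub># (bell_mset z m \<alpha>) = (\<Sum>i = 1..m. i * \<alpha> i)"
  by (induction m) (auto simp: bell_mset_0 bell_mset_Suc)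

lemma filter_replicate_mset:
  "filter_mset P (replicate_mset m x) = (if P x then replicate_mset m x else {#})"
  by (induction m) auto

lemma size_nonzeros_bell_mset:
  "size (filter_mset (\<lambda>j. j \<noteq> 0) (bell_mset z m \<alpha>)) = (\<Sum>i = 1..m. \<alpha> i)"
  by (induction m) (auto simp: bell_mset_0 bell_mset_Suc filter_replicate_mset)

lemma prod_nonzeros_bell_mset:
  fixes g :: "nat \<Rightarrow> 'a :: comm_semiring_1"
  shows "prod_mset (image_mset g (filter_mset (\<lambda>j. j \<noteq> 0) (bell_mset z m \<alpha>))) =
    (\<Prod>i = 1..m. g i ^ \<alpha> i)"
  by (induction m) (auto simp: bell_mset_0 bell_mset_Suc filter_replicate_mset mult.commute)

lemma length_nonzeros_mset: "length (nonzeros js) = size (filter_mset (\<lambda>j. j \<noteq> 0) (mset js))"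
  by (metis mset_filter size_mset)

lemma prod_list_nonzeros_mset:
  fixes g :: "nat \<Rightarrow> 'a :: comm_semiring_1"
  shows "prod_list (map g (nonzeros js)) =
    prod_mset (image_mset g (filter_mset (\<lambda>j. j \<noteq> 0) (mset js)))"
  by (metis mset_filter mset_map prod_mset_prod_list)

text \<open>The multinomial coefficient, cleared of denominators. Values in \<open>{0..m}\<close>
  that do not occur contribute \<open>fact 0 = 1\<close>, so the product may run over the whole
  range.\<close>

lemma card_permutations_of_bell_mset:
  "card (permutations_of_multiset (bell_mset z m \<alpha>)) * (fact z * (\<Prod>i = 1..m. fact (\<alpha> i))) =
     fact (z + (\<Sum>i = 1..m. \<alpha> i))"
proof -
  let ?A = "bell_mset z m \<alpha>"
  have "set_mset ?A \<subseteq> {0..m}"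
    by (auto simp: count_bell_mset simp flip: count_greater_zero_iff split: if_splits)
  then have "(\<Prod>x \<in> set_mset ?A. fact (count ?A x)) = (\<Prod>x \<in> {0..m}. fact (count ?A x) :: nat)"
    by (intro prod.mono_neutral_left) (auto simp: not_in_iff)
  also have "\<dots> = fact z * (\<Prod>i = 1..m. fact (\<alpha> i))"
    by (simp add: prod.atLeast_Suc_atMost[of 0] count_bell_mset)
  finally show ?thesis
    using card_permutations_of_multiset_aux[of ?A] by (simp add: size_bell_mset)
qed

lemma mset_block_list:
  assumes "js \<in> block_lists m k n" and "k \<le> n"
  shows "mset js = bell_mset (m - k) (n - k + 1) (count (mset js))"
proof (rule multiset_eqI)
  fix x
  have js: "length js = m" "length (nonzeros js) = k" "sum_list js = n"
    using assms by (auto simp: block_lists_def)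
  have "count (mset js) 0 + length (nonzeros js) = length js"
    by (induction js) auto
  moreover have "count (mset js) x = 0" if "x > n - k + 1"
    using member_add_length_nonzeros_le[of x js] that js by (fastforce simp: count_eq_zero_iff)
  ultimately show "count (mset js) x = count (bell_mset (m - k) (n - k + 1) (count (mset js))) x"
    using js by (auto simp: count_bell_mset)
qed

text \<open>The multiplicities of 1 to \<open>n - k + 1\<close> fix a block list up to order: there
  are \<open>m - k\<close> zeros, and larger entries cannot occur.\<close>

lemma block_lists_fiber:
  assumes "\<alpha> \<in> bell_indices n k" "k \<le> n" "k \<le> m"
  shows "{js \<in> block_lists m k n. restrict (count (mset js)) {1..n - k + 1} = \<alpha>} =
    permutations_of_multiset (bell_mset (m - k) (n - k + 1) \<alpha>)"
proof (intro equalityI subsetI)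
  fix js assume js: "js \<in> {js \<in> block_lists m k n. restrict (count (mset js)) {1..n - k + 1} = \<alpha>}"
  \<comment> \<open>\<open>bell_mset\<close> reads its function only on
    \<open>{1..n - k + 1}\<close>, so the restriction is invisible to it.\<close>
  then have "bell_mset (m - k) (n - k + 1) (count (mset js)) = bell_mset (m - k) (n - k + 1) \<alpha>"
    unfolding bell_mset_def by (intro arg_cong2[of _ _ _ _ "(+)"] sum.cong) auto
  then show "js \<in> permutations_of_multiset (bell_mset (m - k) (n - k + 1) \<alpha>)"
    using js mset_block_list[of js m k n] assms by (simp add: permutations_of_multiset_def)
next
  fix js assume "js \<in> permutations_of_multiset (bell_mset (m - k) (n - k + 1) \<alpha>)"
  then have js: "mset js = bell_mset (m - k) (n - k + 1) \<alpha>"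
    by (simp add: permutations_of_multiset_def)
  have \<alpha>: "\<alpha> \<in> extensional {1..n - k + 1}" "(\<Sum>i = 1..n - k + 1. \<alpha> i) = k"
      "(\<Sum>i = 1..n - k + 1. i * \<alpha> i) = n"
    using assms by (auto simp: bell_indices_def PiE_def)
  have "length js = m"
    using arg_cong[OF js, of size] \<alpha> assms(3) by (simp only: size_bell_mset size_mset)
  moreover have "length (nonzeros js) = k"
    unfolding length_nonzeros_mset js size_nonzeros_bell_mset by (rule \<alpha>(2))
  moreover have "sum_list js = n"
    using arg_cong[OF js, of sum_mset] \<alpha>(3) by (simp only: sum_mset_bell_mset sum_mset_sum_list)
  moreover have "restrict (count (mset js)) {1..n - k + 1} = \<alpha>"
    by (rule extensionalityI[OF _ \<alpha>(1)]) (auto simp: js count_bell_mset)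
  ultimately show "js \<in> {js \<in> block_lists m k n. restrict (count (mset js)) {1..n - k + 1} = \<alpha>}"
    by (simp add: block_lists_def)
qed

text \<open>Lists are grouped by their multiplicities; the weight is constant on each group, whose
  size is a multinomial coefficient.\<close>

lemma sum_block_lists:
  fixes g :: "nat \<Rightarrow> 'a :: field_char_0"
  assumes "k \<le> n" "k \<le> m"
  shows "(\<Sum>js \<in> block_lists m k n. prod_list (map g (nonzeros js))) =
    (\<Sum>\<alpha> \<in> bell_indices n k. fact m / (fact (m - k) * (\<Prod>i = 1..n - k + 1. fact (\<alpha> i))) *
       (\<Prod>i = 1..n - k + 1. g i ^ \<alpha> i))"
proof -
  let ?\<phi> = "\<lambda>js. restrict (count (mset js)) {1..n - k + 1}"
  let ?W = "\<lambda>js. prod_list (map g (nonzeros js))"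
  have "?\<phi> ` block_lists m k n \<subseteq> bell_indices n k"
  proof safe
    fix js assume js: "js \<in> block_lists m k n"
    note * = mset_block_list[OF js assms(1)]
    have "(\<Sum>i = 1..n - k + 1. count (mset js) i) = k"
      using js length_nonzeros_mset[of js] size_nonzeros_bell_mset[of "m - k" "n - k + 1" "count (mset js)"]
      by (simp only: block_lists_def mem_Collect_eq flip: *)
    moreover have "(\<Sum>i = 1..n - k + 1. i * count (mset js) i) = n"
      using js sum_mset_bell_mset[of "m - k" "n - k + 1" "count (mset js)"]
      by (simp only: block_lists_def mem_Collect_eq sum_mset_sum_list flip: *)
    ultimately show "?\<phi> js \<in> bell_indices n k"
      by (simp add: bell_indices_def)
  qed
  then have "(\<Sum>js \<in> block_lists m k n. ?W js) =
      (\<Sum>\<alpha> \<in> bell_indices n k. \<Sum>js \<in> {js \<in> block_lists m k n. ?\<phi> js = \<alpha>}. ?W js)"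
    by (rule sum.group[OF finite_block_lists finite_bell_indices, symmetric])
  also have "\<dots> = (\<Sum>\<alpha> \<in> bell_indices n k.
      fact m / (fact (m - k) * (\<Prod>i = 1..n - k + 1. fact (\<alpha> i))) * (\<Prod>i = 1..n - k + 1. g i ^ \<alpha> i))"
  proof (rule sum.cong[OF refl])
    fix \<alpha> assume \<alpha>: "\<alpha> \<in> bell_indices n k"
    let ?P = "permutations_of_multiset (bell_mset (m - k) (n - k + 1) \<alpha>)"
    let ?f = "fact (m - k) * (\<Prod>i = 1..n - k + 1. fact (\<alpha> i))"
    have "(\<Sum>js \<in> ?P. ?W js) = (\<Sum>js \<in> ?P. \<Prod>i = 1..n - k + 1. g i ^ \<alpha> i)"
      by (rule sum.cong[OF refl])
         (simp only: prod_list_nonzeros_mset permutations_of_multiset_def mem_Collect_eq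
            prod_nonzeros_bell_mset)
    also have "\<dots> = of_nat (card ?P) * (\<Prod>i = 1..n - k + 1. g i ^ \<alpha> i)"
      by simp
    also have "of_nat (card ?P) = (fact m / ?f :: 'a)"
    proof -
      have "card ?P * ?f = fact m"
        using card_permutations_of_bell_mset[of "m - k" "n - k + 1" \<alpha>] \<alpha> assms(2)
        by (simp add: bell_indices_def del: sum.cl_ivl_Suc prod.cl_ivl_Suc)
      then have "of_nat (card ?P * ?f) = (of_nat (fact m) :: 'a)"
        by (rule arg_cong)
      then show ?thesis
        by (simp add: field_simps del: prod.cl_ivl_Suc)
    qed
    finally show "(\<Sum>js \<in> {js \<in> block_lists m k n. ?\<phi> js = \<alpha>}. ?W js) =
        fact m / ?f * (\<Prod>i = 1..n - k + 1. g i ^ \<alpha> i)"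
      by (simp only: block_lists_fiber[OF \<alpha> assms])
  qed
  finally show ?thesis .
qed

section \<open>Counting the colored words\<close>

definition block_codes :: "nat \<Rightarrow> nat \<Rightarrow> nat \<Rightarrow> nat \<Rightarrow> nat list set" where
  "block_codes a b n k =
     {js \<in> block_lists (a * n + b * k) k n. nonneg_walk (block_step a b) 0 js}"

lemma finite_block_codes: "finite (block_codes a b n k)"
  by (simp add: block_codes_def finite_block_lists)

text \<open>Each entry contributes -1, and a nonzero \<open>j\<close> also \<open>a * j + b\<close>.
  So lists in \<open>block_lists m k n\<close> end at height 0 for \<open>m = a * n + b * k\<close>
  and at -1 for one more entry.\<close>

lemma sum_list_block_step:
  "sum_list (map (block_step a b) js) =
     int (a * sum_list js + b * length (nonzeros js)) - int (length js)"
  by (induction js) (auto simp: block_step_def algebra_simps)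

lemma rotate_block_lists:
  "rotate r js \<in> block_lists m k n \<longleftrightarrow> js \<in> block_lists m k n"
  "prod_list (map g (nonzeros (rotate r js))) = (prod_list (map g (nonzeros js)) :: 'a :: comm_semiring_1)"
proof -
  have mset: "mset (rotate r js) = mset js"
    by (metis add.commute append_take_drop_id mset_append rotate_drop_take)
  then show "rotate r js \<in> block_lists m k n \<longleftrightarrow> js \<in> block_lists m k n"
    unfolding block_lists_def mem_Collect_eq length_nonzeros_mset
    by (metis length_rotate sum_mset_sum_list)
  show "prod_list (map g (nonzeros (rotate r js))) = prod_list (map g (nonzeros js))"
    by (simp only: prod_list_nonzeros_mset mset)
qed

lemma bij_betw_rotate_block_lists: "bij_betw (rotate r) (block_lists m k n) (block_lists m k n)"
proof -
  have "inj_on (rotate r) (block_lists m k n)"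
    by (rule inj_on_subset[of _ UNIV]) (auto simp: rotate_def inj_rotate1 intro: inj_fn)
  moreover have "rotate r ` block_lists m k n \<subseteq> block_lists m k n"
    using rotate_block_lists(1) by blast
  ultimately show ?thesis
    using endo_inj_surj[OF finite_block_lists] by (simp add: bij_betw_def)
qed

text \<open>The prefix condition ignores the last entry and says that the rest is a nonnegative
  walk. As the total is -1, the last step is negative, so the last entry is 0.\<close>

lemma first_passage_block_lists:
  assumes "a + b \<noteq> 0"
  shows "{js \<in> block_lists (Suc (a * n + b * k)) k n.
      \<forall>t < Suc (a * n + b * k). 0 \<le> sum_list (take t (map (block_step a b) js))} =
    (\<lambda>js. js @ [0]) ` block_codes a b n k"
proof -
  let ?N = "a * n + b * k"
  have walk_iff: "(\<forall>t < Suc ?N. 0 \<le> sum_list (take t (map (block_step a b) (js @ [j])))) \<longleftrightarrow>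
      nonneg_walk (block_step a b) 0 js" if "length js = ?N" for js j
    using that by (simp add: nonneg_walk_iff_take less_Suc_eq_le take_map)
  have last_zero: "j = 0"
    if "js @ [j] \<in> block_lists (Suc ?N) k n" and walk: "nonneg_walk (block_step a b) 0 js" for js j
  proof -
    have "sum_list (map (block_step a b) (js @ [j])) = -1"
      using that(1) unfolding sum_list_block_step block_lists_def by simp
    then have "block_step a b j < 0"
      using nonneg_walk_end[OF walk] by simp
    then show ?thesis
      using block_step_neg_iff[OF assms] by simp
  qed
  show ?thesis
  proof (intro equalityI subsetI)
    fix js assume js: "js \<in> {js \<in> block_lists (Suc ?N) k n.
      \<forall>t < Suc ?N. 0 \<le> sum_list (take t (map (block_step a b) js))}"
    then obtain js' j where js': "js = js' @ [j]" "length js' = ?N"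
      unfolding block_lists_def by (auto simp: length_Suc_conv_rev)
    then have walk: "nonneg_walk (block_step a b) 0 js'"
      using js walk_iff by blast
    then have "j = 0"
      using last_zero js js' by blast
    then have "js' \<in> block_codes a b n k"
      using js js' walk by (simp add: block_codes_def block_lists_def)
    then show "js \<in> (\<lambda>js. js @ [0]) ` block_codes a b n k"
      using js' \<open>j = 0\<close> by blast
  next
    fix js assume "js \<in> (\<lambda>js. js @ [0]) ` block_codes a b n k"
    then obtain js' where js': "js = js' @ [0]" "js' \<in> block_codes a b n k"
      by blast
    then have "js \<in> block_lists (Suc ?N) k n" "length js' = ?N"
      "nonneg_walk (block_step a b) 0 js'"
      by (simp_all add: block_codes_def block_lists_def)
    then show "js \<in> {js \<in> block_lists (Suc ?N) k n.
      \<forall>t < Suc ?N. 0 \<le> sum_list (take t (map (block_step a b) js))}"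
      using js'(1) walk_iff by blast
  qed
qed

text \<open>Weighted double counting of the pairs of a list and a rotation amount \<open>r\<close>
  such that the rotated list is good.\<close>

lemma sum_block_lists_eq_block_codes:
  fixes g :: "nat \<Rightarrow> 'a :: comm_semiring_1"
  assumes "a + b \<noteq> 0"
  shows "(\<Sum>js \<in> block_lists (Suc (a * n + b * k)) k n. prod_list (map g (nonzeros js))) =
    of_nat (Suc (a * n + b * k)) * (\<Sum>js \<in> block_codes a b n k. prod_list (map g (nonzeros js)))"
proof -
  let ?M = "Suc (a * n + b * k)"
  let ?S = "block_lists ?M k n"
  let ?W = "\<lambda>js. prod_list (map g (nonzeros js))"
  define good where "good js \<longleftrightarrow> (\<forall>t < ?M. 0 \<le> sum_list (take t (map (block_step a b) js)))" for js
  \<comment> \<open>By the cycle lemma each list has exactly one good rotation amount.\<close>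
  have unique: "(\<Sum>r < ?M. if good (rotate r js) then ?W js else 0) = ?W js" if js: "js \<in> ?S" for js
  proof -
    have "sum_list (map (block_step a b) js) = -1"
      using js unfolding sum_list_block_step block_lists_def by simp
    moreover have "length js = ?M"
      using js by (simp add: block_lists_def)
    ultimately have "\<exists>!r. r < ?M \<and> good (rotate r js)"
      using cycle_lemma[of "map (block_step a b) js"]
      unfolding good_def by (simp only: rotate_map length_map)
    then obtain r where r: "r < ?M" "good (rotate r js)"
        "\<And>r'. r' < ?M \<Longrightarrow> good (rotate r' js) \<Longrightarrow> r' = r"
      by blast
    have "(\<Sum>r' < ?M. if good (rotate r' js) then ?W js else 0) =
        (\<Sum>r' < ?M. if r' = r then ?W js else 0)"
    proof (rule sum.cong[OF refl])
      fix r' assume "r' \<in> {..< ?M}"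
      then have "good (rotate r' js) \<longleftrightarrow> r' = r"
        using r by blast
      then show "(if good (rotate r' js) then ?W js else 0) = (if r' = r then ?W js else 0)"
        by (simp only:)
    qed
    also have "\<dots> = ?W js"
      using r(1) by (simp only: sum.delta' sum.delta finite_lessThan lessThan_iff if_True)
    finally show ?thesis .
  qed
  \<comment> \<open>For fixed \<open>r\<close>, rotation permutes \<open>?S\<close> and preserves
    weights, so the sum does not depend on \<open>r\<close>; this produces the factor
    \<open>?M\<close>.\<close>
  have rotated: "(\<Sum>js \<in> ?S. if good (rotate r js) then ?W js else 0) = (\<Sum>js \<in> {js \<in> ?S. good js}. ?W js)"
    for r
  proof -
    have "(\<Sum>js \<in> ?S. if good (rotate r js) then ?W js else 0) =
        (\<Sum>js \<in> ?S. if good (rotate r js) then ?W (rotate r js) else 0)"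
      by (simp only: rotate_block_lists(2))
    also have "\<dots> = (\<Sum>js \<in> ?S. if good js then ?W js else 0)"
      by (rule sum.reindex_bij_betw[OF bij_betw_rotate_block_lists])
    also have "\<dots> = (\<Sum>js \<in> {js \<in> ?S. good js}. ?W js)"
      by (rule sum.inter_filter[OF finite_block_lists, symmetric])
    finally show ?thesis .
  qed
  have "(\<Sum>js \<in> ?S. ?W js) = (\<Sum>js \<in> ?S. \<Sum>r < ?M. if good (rotate r js) then ?W js else 0)"
    by (rule sum.cong[OF refl]) (simp only: unique)
  also have "\<dots> = (\<Sum>r < ?M. \<Sum>js \<in> ?S. if good (rotate r js) then ?W js else 0)"
    by (rule sum.swap)
  also have "\<dots> = of_nat ?M * (\<Sum>js \<in> {js \<in> ?S. good js}. ?W js)"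
    unfolding rotated by (simp only: sum_constant card_lessThan)
  also have "{js \<in> ?S. good js} = (\<lambda>js. js @ [0]) ` block_codes a b n k"
    unfolding good_def by (rule first_passage_block_lists[OF assms])
  \<comment> \<open>The appended 0 is dropped by \<open>nonzeros\<close>, so the weight stays the
    same.\<close>
  also have "(\<Sum>js \<in> (\<lambda>js. js @ [0]) ` block_codes a b n k. ?W js) = (\<Sum>js \<in> block_codes a b n k. ?W js)"
    by (subst sum.reindex) (auto simp: inj_on_def)
  finally show ?thesis .
qed

text \<open>With N = \<open>a * n + b * k\<close>, dividing (N+1)!/(N+1-k)! by N+1 leaves
  N!/(N+1-k)!, which is the binomial coefficient times \<open>fact (k - 1)\<close>.\<close>

lemma sum_block_codes:
  assumes "a + b \<noteq> 0" "1 \<le> k" "k \<le> n"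
  shows "(\<Sum>js \<in> block_codes a b n k. prod_list (map (\<lambda>j. real (c j)) (nonzeros js))) =
    real ((a * n + b * k) choose (k - 1)) * (fact (k - 1) / fact n) *
      partial_bell n k (\<lambda>j. fact j * real (c j))"
proof -
  let ?N = "a * n + b * k"
  \<comment> \<open>\<open>Q\<close> is the Bell polynomial divided by \<open>fact n\<close>: the
    \<open>fact j\<close> in its arguments cancels the denominators \<open>fact i\<close>.\<close>
  define Q where "Q = (\<Sum>\<alpha> \<in> bell_indices n k.
    (\<Prod>i = 1..n - k + 1. real (c i) ^ \<alpha> i) / (\<Prod>i = 1..n - k + 1. fact (\<alpha> i)))"
  \<comment> \<open>This keeps the subtractions under the factorials from truncating. If
    \<open>a = 0\<close> then \<open>b\<close> is positive and \<open>k \<le> b * k\<close>;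
    otherwise \<open>k \<le> n \<le> a * n\<close>.\<close>
  have N: "k \<le> ?N"
  proof (cases "a = 0")
    case False
    then have "n \<le> a * n"
      by simp
    then show ?thesis
      using assms(3) by linarith
  qed (use assms in simp)
  then have k: "k \<le> Suc ?N" "k - 1 \<le> ?N" "?N - (k - 1) = Suc ?N - k"
    using assms(2) by auto
  have "fact (Suc ?N) / (fact (Suc ?N - k) * (\<Prod>i = 1..n - k + 1. fact (\<alpha> i))) *
        (\<Prod>i = 1..n - k + 1. real (c i) ^ \<alpha> i) =
      fact (Suc ?N) / fact (Suc ?N - k) *
        ((\<Prod>i = 1..n - k + 1. real (c i) ^ \<alpha> i) / (\<Prod>i = 1..n - k + 1. fact (\<alpha> i)))" for \<alpha>
    by (simp only: times_divide_eq_left times_divide_eq_right divide_divide_eq_left mult.commute)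
  then have "real (Suc ?N) * (\<Sum>js \<in> block_codes a b n k. prod_list (map (\<lambda>j. real (c j)) (nonzeros js))) =
      fact (Suc ?N) / fact (Suc ?N - k) * Q"
    unfolding sum_block_lists_eq_block_codes[OF assms(1), symmetric]
      sum_block_lists[OF assms(3) k(1)] Q_def
    by (simp only: sum_distrib_left)
  then have "(\<Sum>js \<in> block_codes a b n k. prod_list (map (\<lambda>j. real (c j)) (nonzeros js))) =
      fact ?N / fact (Suc ?N - k) * Q"
    by (simp add: field_simps del: of_nat_Suc)
  moreover have "partial_bell n k (\<lambda>j. fact j * real (c j)) = fact n * Q"
    unfolding partial_bell_def Q_def sum_distrib_left by (intro sum.cong refl) simp
  moreover have "real (?N choose (k - 1)) * fact (k - 1) = fact ?N / fact (Suc ?N - k)"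
    using binomial_fact[OF k(2), where ?'a = real] k(3) by simp
  ultimately show ?thesis
    by simp
qed

section \<open>From codes back to colored words\<close>

lemma dyck_words_ab_eq:
  assumes "a + b \<noteq> 0"
  shows "{w \<in> dyck_words_ab a b n. peaks w = k} = block_word a b ` block_codes a b n k"
proof -
  have "(a + b) * sum_list js = (a + b) * n \<longleftrightarrow> sum_list js = n" for js
    using assms by (simp only: mult_cancel1) blast
  then have code_iff: "dyck_word ((a + b) * n) (block_word a b js) \<and> length (nonzeros js) = k \<longleftrightarrow>
      js \<in> block_codes a b n k" for js
    unfolding dyck_word_block_word_iff block_codes_def block_lists_def mem_Collect_eq
    by (auto simp only: distrib_right)
  \<comment> \<open>An entry is at most the total \<open>n\<close>, which supplies the index bound
    in \<open>dyck_words_ab\<close>.\<close>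
  have set_subset: "set js \<subseteq> {0..n}" if "js \<in> block_codes a b n k" for js
    using that by (auto simp: block_codes_def block_lists_def dest: member_le_sum_list)
  show ?thesis
  proof (intro equalityI subsetI)
    fix w assume "w \<in> {w \<in> dyck_words_ab a b n. peaks w = k}"
    then obtain js where "w = block_word a b js" "dyck_word ((a + b) * n) (block_word a b js)"
        "length (nonzeros js) = k"
      unfolding dyck_words_ab_def by (auto simp only: peaks_block_word[OF assms] mem_Collect_eq)
    then show "w \<in> block_word a b ` block_codes a b n k"
      using code_iff by blast
  next
    fix w assume "w \<in> block_word a b ` block_codes a b n k"
    then obtain js where js: "w = block_word a b js" "js \<in> block_codes a b n k"
      by blast
    then have "dyck_word ((a + b) * n) w" "peaks w = k"
      using code_iff[of js] js peaks_block_word[OF assms, of js] by simp_all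
    then show "w \<in> {w \<in> dyck_words_ab a b n. peaks w = k}"
      unfolding dyck_words_ab_def using js set_subset by blast
  qed
qed

text \<open>Codes index the words injectively, and the colorings of one word form a finite product
  set whose size is the weight of its code.\<close>

lemma colored_with_peaks:
  assumes "a + b \<noteq> 0"
  shows "finite {(w, col) \<in> colored_dyck_words a b c n. peaks w = k}" (is "finite ?T")
    and "card {(w, col) \<in> colored_dyck_words a b c n. peaks w = k} =
      (\<Sum>js \<in> block_codes a b n k. prod_list (map c (nonzeros js)))"
proof -
  let ?C = "\<lambda>w. \<Pi>\<^sub>E (i, l) \<in> maximal_ascents w. {..<c (l div (a + b))}"
  have T: "?T = (SIGMA w : block_word a b ` block_codes a b n k. ?C w)"
    unfolding dyck_words_ab_eq[OF assms, symmetric] colored_dyck_words_def by auto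
  have fin: "finite (?C w)" for w
    by (rule finite_PiE) (auto simp: finite_maximal_ascents)
  show "finite ?T"
    unfolding T using fin by (intro finite_SigmaI) (simp_all add: finite_block_codes)
  have card_C: "card (?C (block_word a b js)) = prod_list (map c (nonzeros js))" for js
    unfolding card_PiE[OF finite_maximal_ascents] prod_maximal_ascents_block_word[OF assms, symmetric]
    by (intro prod.cong) auto
  have "card ?T = (\<Sum>w \<in> block_word a b ` block_codes a b n k. card (?C w))"
    unfolding T using fin by (intro card_SigmaI) (simp_all add: finite_block_codes)
  also have "\<dots> = (\<Sum>js \<in> block_codes a b n k. prod_list (map c (nonzeros js)))"
    using inj_block_word[OF assms] card_C
    by (subst sum.reindex) (auto intro: inj_on_subset)
  finally show "card ?T = (\<Sum>js \<in> block_codes a b n k. prod_list (map c (nonzeros js)))" .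
qed

text \<open>Peaks correspond to the nonzero indices, whose total is \<open>n\<close>: a positive
  total needs at least one, and each contributes at least 1.\<close>

lemma peaks_bounds:
  assumes "a + b \<noteq> 0" "1 \<le> n" "w \<in> dyck_words_ab a b n"
  shows "1 \<le> peaks w" "peaks w \<le> n"
proof -
  obtain js where js: "js \<in> block_codes a b n (peaks w)"
    using dyck_words_ab_eq[OF assms(1), of n "peaks w"] assms(3) by blast
  have zero: "nonzeros js = [] \<Longrightarrow> sum_list js = 0" for js
    by (induction js) (auto split: if_splits)
  have "length (nonzeros js) = peaks w" "sum_list js = n"
    using js
    by (auto simp: block_codes_def block_lists_def)
  then show "1 \<le> peaks w" "peaks w \<le> n"
    using length_nonzeros_le_sum_list[of js] assms(2) zero[of js]
    by (auto simp: Suc_le_eq intro!: Nat.gr0I)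
qed

theorem theorem3p5:
  fixes a b n :: nat and c :: "nat \<Rightarrow> nat"
  assumes "a + b \<noteq> 0" and "n \<ge> 1"
  shows "real (card (colored_dyck_words a b c n)) =
           (\<Sum>k = 1..n. real ((a * n + b * k) choose (k - 1)) * (fact (k - 1) / fact n) *
              partial_bell n k (\<lambda>j. fact j * real (c j))) \<and>
         (\<forall>k. 1 \<le> k \<and> k \<le> n \<longrightarrow>
            real ((a * n + b * k) choose (k - 1)) * (fact (k - 1) / fact n) *
              partial_bell n k (\<lambda>j. fact j * real (c j)) =
            real (card {(w, col) \<in> colored_dyck_words a b c n. peaks w = k}))"
proof -
  let ?T = "\<lambda>k. {(w, col) \<in> colored_dyck_words a b c n. peaks w = k}"
  let ?F = "\<lambda>k. real ((a * n + b * k) choose (k - 1)) * (fact (k - 1) / fact n) *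
    partial_bell n k (\<lambda>j. fact j * real (c j))"
  have T: "?F k = real (card (?T k))" if "1 \<le> k" "k \<le> n" for k
  proof -
    have of_nat_weight: "real (prod_list (map c js)) = prod_list (map (\<lambda>j. real (c j)) js)" for js
      by (induction js) auto
    show ?thesis
      unfolding colored_with_peaks(2)[OF assms(1)] sum_block_codes[OF assms(1) that, symmetric]
      by (simp add: of_nat_weight)
  qed
  \<comment> \<open>The bounds on the number of peaks make the disjoint classes for \<open>k\<close>
    from 1 to \<open>n\<close> exhaust all colored words.\<close>
  have "colored_dyck_words a b c n = (\<Union>k \<in> {1..n}. ?T k)"
    using peaks_bounds[OF assms] by (auto simp: colored_dyck_words_def)
  then have "card (colored_dyck_words a b c n) = card (\<Union>k \<in> {1..n}. ?T k)"
    by (rule arg_cong)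
  also have "\<dots> = (\<Sum>k = 1..n. card (?T k))"
    using colored_with_peaks(1)[OF assms(1)] by (intro card_UN_disjoint) auto
  finally have "real (card (colored_dyck_words a b c n)) = (\<Sum>k = 1..n. ?F k)"
    using T by simp
  then show ?thesis
    using T by blast
qed

end
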